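(* Let $n\ge 1$, $k\in\mathbb{Z}$ and $a\in\mathbb{C}$ with $a\neq0$. Then \[ PC_{n}^{(k)}(x:a)=-PC_{n-1}^{(k)}(x:a)-\frac{1}{a}\,x\,PC_{n-1}^{(k)}(x+1:a)+\frac{1}{n}\sum_{l=0}^{n-1}\binom{n}{l}\frac{\hat{C}_{l}}{a^{l}}\left\{PC_{n-l}^{(k-1)}(x:a)-PC_{n-l}^{(k)}(x:a)\right\}. \]
   Context: For an integer $k$, $\mathrm{Lif}_k(t)=\sum_{n=0}^{\infty}\frac{t^{n}}{n!\,(n+1)^{k}}$. For $a\neq0$ and any integer $k$, $PC_n^{(k)}(x:a)$ is defined by $e^{-t}\,\mathrm{Lif}_k\!\left(\log\left(1+\frac{t}{a}\right)\right)\left(1+\frac{t}{a}\right)^{-x}=\sum_{n\ge0}PC_n^{(k)}(x:a)\frac{t^n}{n!}$. The Cauchy numbers of the second kind $\hat{C}_n$ are defined by $\frac{t}{(1+t)\log(1+t)}=\sum_{n\ge0}\hat{C}_n\frac{t^n}{n!}$. *)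

theory Defs
  imports Complex_Main "HOL-Computational_Algebra.Formal_Power_Series"
begin

text \<open>
  All generating functions are formal power series in \<open>t\<close> over the complex numbers. In the library,
  \<open>fps_ln 1\<close> is \<open>log (1 + t)\<close> (in general \<open>fps_ln c\<close> is \<open>log (1 + t) / c\<close>) and
  \<open>fps_binomial c\<close> is \<open>(1 + t)\<close> to the power \<open>c\<close>.
\<close>

definition Lif :: "int \<Rightarrow> complex fps" where
  "Lif k = Abs_fps (\<lambda>n. 1 / (fact n * (of_nat n + 1) powi k))"

definition PC_gf :: "int \<Rightarrow> complex \<Rightarrow> complex \<Rightarrow> complex fps" where
  "PC_gf k x a =
     (let u = fps_const (1 / a) * fps_X
      in fps_exp (- 1) * (Lif k oo (fps_ln 1 oo u)) * (fps_binomial (- x) oo u))"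

text \<open>\<open>PC n k x a\<close> stands for \<open>PC\<^sub>n\<^sup>(\<^sup>k\<^sup>)(x : a)\<close>; it is meaningful for \<open>a \<noteq> 0\<close> only.\<close>

definition PC :: "nat \<Rightarrow> int \<Rightarrow> complex \<Rightarrow> complex \<Rightarrow> complex" where
  "PC n k x a = fact n * fps_nth (PC_gf k x a) n"

text \<open>The quotient is an exact one: both \<open>t\<close> and \<open>(1 + t) log (1 + t)\<close> have order one at zero.\<close>

definition Cauchy2 :: "nat \<Rightarrow> complex" where
  "Cauchy2 n = fact n * fps_nth (fps_X / ((1 + fps_X) * fps_ln 1)) n"

lemma PC_generating_function: "Abs_fps (\<lambda>n. PC n k x a / fact n) = PC_gf k x a"
  by (simp add: PC_def fps_eq_iff)

lemma Cauchy2_generating_function: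
  "Abs_fps (\<lambda>n. Cauchy2 n / fact n) * ((1 + fps_X) * fps_ln 1) = fps_X"
proof -
  let ?g = "(1 + fps_X) * fps_ln 1 :: complex fps"
  have g1: "fps_nth ?g 1 = 1"
    by (simp add: fps_ln_nth distrib_right)
  hence nz: "?g \<noteq> 0" by (metis fps_zero_nth zero_neq_one)
  have "subdegree ?g \<le> 1"
    using g1 by (intro subdegree_leI) simp
  hence "?g dvd fps_X"
    using nz by (simp add: fps_dvd_iff)
  moreover have "Abs_fps (\<lambda>n. Cauchy2 n / fact n) = fps_X / ?g"
    by (simp add: Cauchy2_def fps_eq_iff)
  ultimately show ?thesis
    by (metis dvd_div_mult_self)
qed

end

theory Submission
  imports Defs
begin

text \<open>
  Write \<open>F\<^sub>k\<^sub>,\<^sub>x\<close> for the generating function and \<open>L = log (1 + t/a)\<close>. Differentiating \<open>F\<^sub>k\<^sub>,\<^sub>x\<close> in \<open>t\<close>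
  leaves one nontrivial term, containing \<open>Lif\<^sub>k'(L) L'\<close>. Since \<open>z Lif\<^sub>k'(z) = Lif\<^sub>k\<^sub>-\<^sub>1(z) - Lif\<^sub>k(z)\<close> and
  \<open>t L' = C(t/a) L\<close>, where \<open>C\<close> generates the Cauchy numbers, multiplying by \<open>t\<close> yields
  \<open>t F\<^sub>k\<^sub>,\<^sub>x' = - t F\<^sub>k\<^sub>,\<^sub>x - (x/a) t F\<^sub>k\<^sub>,\<^sub>x\<^sub>+\<^sub>1 + C(t/a) (F\<^sub>k\<^sub>-\<^sub>1\<^sub>,\<^sub>x - F\<^sub>k\<^sub>,\<^sub>x)\<close>.
  The recurrence is the comparison of coefficients; its term \<open>l = n\<close> is absent because
  \<open>Lif\<^sub>k\<close> has constant coefficient 1 for all \<open>k\<close>.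
\<close>

text \<open>Coefficientwise this is \<open>n = (n + 1) - 1\<close> over
  \<open>fact n * (n + 1) powi k\<close>: the factor \<open>n + 1\<close> lowers the exponent
  \<open>k\<close> by one.\<close>

lemma fps_X_mult_deriv_Lif: "fps_X * fps_deriv (Lif k) = Lif (k - 1) - Lif k"
proof (rule fps_ext)
  fix n
  show "fps_nth (fps_X * fps_deriv (Lif k)) n = fps_nth (Lif (k - 1) - Lif k) n"
  proof (cases n)
    case (Suc m)
    have nz: "(2 + of_nat m :: complex) \<noteq> 0"
      using of_nat_neq_0[of "Suc m", where ?'a = complex] by (simp add: add.commute add_ac)
    show ?thesis
      using nz by (simp add: Lif_def Suc power_int_diff field_simps del: fact_Suc)
  qed (simp add: Lif_def)
qed

lemma fps_deriv_binomial_uminus: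
  "fps_deriv (fps_binomial (- x)) = fps_const (- x) * fps_binomial (- (x + 1) :: complex)"
  by (rule fps_ext) (use gbinomial_absorption[of _ "- x"] in simp)

text \<open>Both sides equal \<open>u / (1 + u)\<close>: the left by the chain rule, the right by
  the defining relation of the Cauchy numbers taken at \<open>u\<close>.\<close>

lemma fps_X_mult_deriv_ln_compose_linear:
  fixes c :: complex
  defines "u \<equiv> fps_const c * fps_X"
  shows "fps_X * fps_deriv (fps_ln 1 oo u) =
    (Abs_fps (\<lambda>n. Cauchy2 n / fact n) oo u) * (fps_ln 1 oo u)"
proof -
  let ?C = "Abs_fps (\<lambda>n. Cauchy2 n / fact n)"
  have u0: "fps_nth u 0 = 0"
    by (simp add: u_def)
  have inv: "inverse (1 + fps_X) * (1 + fps_X) = (1 :: complex fps)"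
    by (rule inverse_mult_eq_1) simp
  \<comment> \<open>The inserted unit supplies the factor \<open>1 + fps_X\<close> that the defining
    relation of \<open>?C\<close> requires.\<close>
  have "?C * fps_ln 1 = inverse (1 + fps_X) * (1 + fps_X) * (?C * fps_ln 1)"
    by (simp add: inv)
  also have "\<dots> = inverse (1 + fps_X) * (?C * ((1 + fps_X) * fps_ln 1))"
    by (simp only: ac_simps)
  also have "\<dots> = inverse (1 + fps_X) * fps_X"
    by (simp only: Cauchy2_generating_function)
  finally have "(?C oo u) * (fps_ln 1 oo u) = (inverse (1 + fps_X) oo u) * u"
    using u0 by (simp flip: fps_compose_mult_distrib) (simp add: fps_compose_mult_distrib)
  moreover have "fps_deriv (fps_ln 1 oo u) = (inverse (1 + fps_X) oo u) * fps_const c"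
    using u0 by (simp add: fps_compose_deriv fps_ln_deriv) (simp add: u_def)
  ultimately show ?thesis
    by (simp add: u_def mult_ac)
qed

lemma fps_X_mult_deriv_PC_gf:
  "fps_X * fps_deriv (PC_gf k x a) =
     - (fps_X * PC_gf k x a) - fps_const (x / a) * (fps_X * PC_gf k (x + 1) a)
     + (Abs_fps (\<lambda>n. Cauchy2 n / fact n) oo (fps_const (1 / a) * fps_X))
       * (PC_gf (k - 1) x a - PC_gf k x a)"
proof -
  define u where "u = fps_const (1 / a) * fps_X"
  define L where "L = (fps_ln 1 oo u)"
  define E where "E = (fps_exp (- 1) :: complex fps)"
  define B where "B = (\<lambda>x. fps_binomial (- x) oo u)"
  let ?C = "Abs_fps (\<lambda>n. Cauchy2 n / fact n) oo u"
  have F: "PC_gf k x a = E * (Lif k oo L) * B x" for k x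
    by (simp add: PC_gf_def Let_def u_def L_def E_def B_def)
  have u0: "fps_nth u 0 = 0"
    by (simp add: u_def)
  have L0: "fps_nth L 0 = 0"
    by (simp add: L_def fps_ln_nth)
  have dE: "fps_deriv E = - E"
    by (simp add: E_def flip: fps_const_neg)
  have "fps_deriv (B x) = fps_const (- x) * B (x + 1) * fps_deriv u"
    using u0 by (simp add: B_def fps_compose_deriv fps_deriv_binomial_uminus fps_compose_mult_distrib)
  also have "\<dots> = fps_const (- x) * fps_const (1 / a) * B (x + 1)"
    by (simp add: u_def del: fps_const_mult)
  finally have dB: "fps_deriv (B x) = - (fps_const (x / a) * B (x + 1))"
    by (simp flip: fps_const_neg)
  have dL: "fps_X * fps_deriv L = ?C * L"
    unfolding L_def u_def by (rule fps_X_mult_deriv_ln_compose_linear)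
  have Lif: "L * (fps_deriv (Lif k) oo L) = (Lif (k - 1) oo L) - (Lif k oo L)"
    using arg_cong[OF fps_X_mult_deriv_Lif, of "\<lambda>f. f oo L" k] L0
    by (simp add: fps_compose_mult_distrib fps_compose_sub_distrib)
  have "fps_X * fps_deriv (PC_gf k x a) =
      - (fps_X * PC_gf k x a) - fps_const (x / a) * (fps_X * PC_gf k (x + 1) a)
      + E * (fps_deriv (Lif k) oo L) * B x * (fps_X * fps_deriv L)"
    using L0 by (simp add: F dE dB fps_compose_deriv algebra_simps)
  \<comment> \<open>The factor \<open>fps_X\<close> turns \<open>fps_deriv L\<close> into
    \<open>?C * L\<close>, and this \<open>L\<close> is what the identity for \<open>Lif\<close>
    needs.\<close>
  also have "E * (fps_deriv (Lif k) oo L) * B x * (fps_X * fps_deriv L) =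
      ?C * E * B x * (L * (fps_deriv (Lif k) oo L))"
    by (simp only: dL ac_simps)
  also have "\<dots> = ?C * (PC_gf (k - 1) x a - PC_gf k x a)"
    by (simp add: Lif F algebra_simps)
  finally show ?thesis
    by (simp add: u_def)
qed

lemma PC_0: "PC 0 k x a = 1"
  by (simp add: PC_def PC_gf_def Let_def Lif_def)

theorem theorem6:
  fixes n :: nat and k :: int and a x :: complex
  assumes "n \<ge> 1" and "a \<noteq> 0"
  shows "PC n k x a =
           - PC (n - 1) k x a - (1 / a) * x * PC (n - 1) k (x + 1) a
           + (1 / of_nat n) *
             (\<Sum>l=0..n-1. of_nat (n choose l) * (Cauchy2 l / a ^ l) *
               (PC (n - l) (k - 1) x a - PC (n - l) k x a))"
proof -
  obtain m where n: "n = Suc m"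
    using assms(1) by (cases n) auto
  define T where "T = (\<lambda>l. of_nat (n choose l) * (Cauchy2 l / a ^ l) *
    (PC (n - l) (k - 1) x a - PC (n - l) k x a))"
  have nth: "fps_nth (PC_gf k x a) i = PC i k x a / fact i" for i k x
    by (simp add: PC_def)
  have "of_nat n * PC n k x a / fact n = fps_nth (fps_X * fps_deriv (PC_gf k x a)) n"
    by (simp add: n nth del: fact_Suc of_nat_Suc)
  \<comment> \<open>The factor \<open>fps_X\<close> shifts the first two terms to index
    \<open>m = n - 1\<close>; the Cauchy product stays at \<open>n\<close>.\<close>
  also have "\<dots> = - (PC m k x a / fact m) - x / a * (PC m k (x + 1) a / fact m)
      + (\<Sum>l=0..n. (1 / a) ^ l * (Cauchy2 l / fact l) *
          ((PC (n - l) (k - 1) x a - PC (n - l) k x a) / fact (n - l)))"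
    by (simp add: fps_X_mult_deriv_PC_gf fps_mult_nth[of "Abs_fps _"] fps_compose_linear nth
        diff_divide_distrib n mult.commute[of a] del: sum.atLeast0_atMost_Suc fact_Suc)
  also have "(\<Sum>l=0..n. (1 / a) ^ l * (Cauchy2 l / fact l) *
          ((PC (n - l) (k - 1) x a - PC (n - l) k x a) / fact (n - l))) =
      (\<Sum>l=0..n. T l / fact n)"
    by (rule sum.cong) (simp_all add: T_def binomial_fact power_divide)
  also have "\<dots> = (\<Sum>l=0..m. T l) / fact n"
    unfolding sum_divide_distrib[symmetric] by (simp add: n T_def PC_0)
  finally have "of_nat n * PC n k x a =
      (- (PC m k x a / fact m) - x / a * (PC m k (x + 1) a / fact m)
        + (\<Sum>l=0..m. T l) / fact n) * fact n"
    by (subst (asm) divide_eq_eq) simp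
  \<comment> \<open>Here \<open>fact n / fact m = n\<close>, so the final division by
    \<open>n\<close> leaves \<open>1 / n\<close> on the sum only.\<close>
  also have "\<dots> = of_nat n * (- PC m k x a - 1 / a * x * PC m k (x + 1) a) + (\<Sum>l=0..m. T l)"
    by (simp add: n distrib_right left_diff_distrib right_diff_distrib del: of_nat_Suc)
  finally have "PC n k x a =
      (of_nat n * (- PC m k x a - 1 / a * x * PC m k (x + 1) a) + (\<Sum>l=0..m. T l)) / of_nat n"
    using n by (simp add: eq_divide_eq mult.commute del: of_nat_Suc)
  also have "\<dots> = - PC m k x a - 1 / a * x * PC m k (x + 1) a + 1 / of_nat n * (\<Sum>l=0..m. T l)"
    using n by (simp add: add_divide_distrib del: of_nat_Suc)
  finally show ?thesis
    by (simp add: n T_def)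
qed

end
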